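(* Let $\alpha \in \overline{-\mathbb{H}}$, let $U \subset \mathbb{C}$ be a simply connected domain containing $\overline{\mathbb{H}} \setminus \{\alpha\}$, and let $f : U \to \mathbb{C}$ be an injective holomorphic function such that $f(\overline{\mathbb{H}} \setminus \{\alpha\})$ is convex. Let $(X_i)_{i \ge 1}$ be i.i.d. real-valued continuous random variables. If $E[|f(X_1)|] < +\infty$, then almost surely \[ \lim_{n \to \infty} f^{-1}\left(\frac{1}{n} \sum_{j=1}^{n} f(X_j)\right) = f^{-1}\left(E[f(X_1)]\right). \]
   Context: $\overline{\mathbb{H}} = \{x+yi : x \in \mathbb{R},\, y \ge 0\}$ and $\overline{-\mathbb{H}} = \{x+yi : x \in \mathbb{R},\, y \le 0\}$. If $\alpha \notin \mathbb{R}$, then $\overline{\mathbb{H}} \setminus \{\alpha\} = \overline{\mathbb{H}}$. The map $f^{-1} : f(U) \to U$ is the (holomorphic) inverse of $f$. A real-valued random variable $X$ is called continuous if $P(X = x) = 0$ for every $x \in \mathbb{R}$ (so $f(X_j)$ is defined almost surely). For a complex-valued random variable $Y$, $E[Y] := E[\mathrm{Re}(Y)] + i E[\mathrm{Im}(Y)]$. *)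

theory Defs
  imports "HOL-Probability.Probability" "HOL-Complex_Analysis.Complex_Analysis"
begin

definition closed_upper_half_plane :: "complex set" where
  "closed_upper_half_plane = {z. Im z \<ge> 0}"

definition closed_lower_half_plane :: "complex set" where
  "closed_lower_half_plane = {z. Im z \<le> 0}"

definition simply_connected_domain :: "complex set \<Rightarrow> bool" where
  "simply_connected_domain U \<longleftrightarrow> open U \<and> connected U \<and> simply_connected U"

text \<open>A continuous random variable is one without atoms; no density is required.\<close>

definition continuous_random_variable :: "'a measure \<Rightarrow> ('a \<Rightarrow> real) \<Rightarrow> bool" where
  "continuous_random_variable M X \<longleftrightarrow>
     X \<in> borel_measurable M \<and> (\<forall>x. measure M {\<omega> \<in> space M. X \<omega> = x} = 0)"

definition iid_from_1 :: "'a measure \<Rightarrow> (nat \<Rightarrow> 'a \<Rightarrow> real) \<Rightarrow> bool" where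
  "iid_from_1 M X \<longleftrightarrow>
     prob_space.indep_vars M (\<lambda>_. borel) X {1..} \<and>
     (\<forall>i\<ge>1. distr M borel (X i) = distr M borel (X 1))"

end

theory Submission imports Defs begin

text \<open>By the strong law of large numbers the means of \<open>f (X j)\<close> tend almost surely to
  \<open>m = E[f (X 1)]\<close>. As \<open>f (X 1)\<close> lies almost surely in a convex set of finite dimension, so does
  \<open>m\<close>, even when that set is not closed. Hence \<open>m\<close> is in the open set \<open>f ` U\<close>, on which the inverse
  of \<open>f\<close> is continuous.

  The strong law follows Etemadi: for nonnegative pairwise independent summands, truncation at
  \<open>a^n\<close> along the first \<open>\<lfloor>a^n\<rfloor>\<close> summands makes both the truncation errors and the variances
  summable by geometric series; monotonicity of the partial sums interpolates between consecutive
  powers, and \<open>a\<close> tends to 1.\<close>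

section \<open>Geometric series bounds for truncation at powers\<close>

text \<open>A geometric sum is at most its largest term times \<open>a / (a - 1)\<close>, and every
  nonzero term here is below \<open>y\<close>. Taken at \<open>y = Y 0 \<omega>\<close> and
  integrated, this controls the probabilities that truncation changes a summand.\<close>

lemma sum_powers_below_le:
  fixes a y :: real
  assumes "a > 1" "y \<ge> 0"
  shows "(\<Sum>n<N. if a^n < y then a^n else 0) \<le> y * (a / (a - 1))"
proof -
  \<comment> \<open>The first entry of the minimum bounds the full geometric sum; the induction
    needs it while \<open>a^N < y\<close>, and the second entry takes over afterwards.\<close>
  have "(\<Sum>n<N. if a^n < y then a^n else 0) \<le> min (a^N / (a - 1)) (y * (a / (a - 1)))"
  proof (induction N)
    case 0
    then show ?case using assms by simp
  next
    case (Suc N)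
    have mono: "a^N / (a - 1) \<le> a^Suc N / (a - 1)"
      using assms by (intro divide_right_mono power_increasing) auto
    show ?case
    proof (cases "a^N < y")
      case True
      have eq: "a^N / (a - 1) + a^N = a^N * (a / (a - 1))"
        using assms by (simp add: field_simps)
      have "a^N * (a / (a - 1)) \<le> y * (a / (a - 1))"
        using True assms by (intro mult_right_mono) auto
      moreover have "(\<Sum>n<Suc N. if a^n < y then a^n else 0) \<le> a^N * (a / (a - 1))"
        using Suc.IH True eq by simp
      ultimately show ?thesis by (simp add: mult.commute)
    next
      case False
      then show ?thesis using Suc.IH mono by simp
    qed
  qed
  then show ?thesis by simp
qed

text \<open>The nonzero terms decay with ratio \<open>1 / a\<close>, and the first of them is at
  most \<open>y\<close> because there \<open>y \<le> a^n\<close>. After integration this controls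
  the variances of the truncated averages.\<close>

lemma sum_inverse_powers_above_le:
  fixes a y :: real
  assumes "a > 1" "y \<ge> 0"
  shows "(\<Sum>n<N. (if y \<le> a^n then y else 0)\<^sup>2 / a^n) \<le> y * (a / (a - 1))"
proof -
  \<comment> \<open>The added product bounds the tail from index \<open>N\<close> on, so the left
    side does not increase with \<open>N\<close>.\<close>
  have "(\<Sum>n<N. (if y \<le> a^n then y else 0)\<^sup>2 / a^n) + min y (y\<^sup>2 / a^N) * (a / (a - 1))
      \<le> y * (a / (a - 1))"
  proof (induction N)
    case 0
    have "min y (y\<^sup>2) * (a / (a - 1)) \<le> y * (a / (a - 1))"
      using assms by (intro mult_right_mono) auto
    then show ?case by simp
  next
    case (Suc N)
    have apos: "a^N > 0" using assms by simp
    show ?case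
    proof (cases "y \<le> a^N")
      case True
      then have le: "y * y \<le> y * a^N" using assms by (intro mult_left_mono)
      then have m: "min y (y\<^sup>2 / a^N) = y\<^sup>2 / a^N"
        using apos by (simp add: min_def field_simps power2_eq_square)
      have "min y (y\<^sup>2 / a^Suc N) * (a / (a - 1)) \<le> y\<^sup>2 / a^Suc N * (a / (a - 1))"
        using assms by (intro mult_right_mono) auto
      also have "\<dots> = y\<^sup>2 / a^N * (a / (a - 1)) - y\<^sup>2 / a^N"
        using assms apos by (simp add: divide_simps) (simp add: algebra_simps)
      finally show ?thesis using Suc.IH True unfolding m by simp
    next
      case False
      have "y\<^sup>2 / a^Suc N \<le> y\<^sup>2 / a^N"
        using assms by (intro divide_left_mono power_increasing) auto
      then have "min y (y\<^sup>2 / a^Suc N) * (a / (a - 1)) \<le> min y (y\<^sup>2 / a^N) * (a / (a - 1))"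
        using assms by (intro mult_right_mono) auto
      then show ?thesis using Suc.IH False by simp
    qed
  qed
  moreover have "0 \<le> min y (y\<^sup>2 / a^N) * (a / (a - 1))"
    using assms by (intro mult_nonneg_nonneg) auto
  ultimately show ?thesis by linarith
qed

section \<open>Almost sure convergence and second moments\<close>

text \<open>By monotone convergence the series of the \<open>Q n\<close> has finite integral, so it
  converges almost everywhere and its terms vanish in the limit. Applied to squared deviations, this
  stands in for Chebyshev followed by Borel-Cantelli.\<close>

lemma AE_tendsto_0_of_summable_integral:
  fixes Q :: "nat \<Rightarrow> 'a \<Rightarrow> real"
  assumes int: "\<And>n. integrable M (Q n)"
    and nonneg: "\<And>n \<omega>. 0 \<le> Q n \<omega>"
    and sum: "summable (\<lambda>n. integral\<^sup>L M (Q n))"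
  shows "AE \<omega> in M. (\<lambda>n. Q n \<omega>) \<longlonglongrightarrow> 0"
proof -
  have [measurable]: "Q n \<in> borel_measurable M" for n
    using int by auto
  have "(\<integral>\<^sup>+\<omega>. (\<Sum>n. ennreal (Q n \<omega>)) \<partial>M) = (\<Sum>n. \<integral>\<^sup>+\<omega>. ennreal (Q n \<omega>) \<partial>M)"
    by (rule nn_integral_suminf) measurable
  also have "\<dots> = (\<Sum>n. ennreal (integral\<^sup>L M (Q n)))"
    using int nonneg by (simp add: nn_integral_eq_integral)
  also have "\<dots> < \<infinity>"
    using sum nonneg by (simp add: suminf_ennreal2 less_top[symmetric])
  finally have "AE \<omega> in M. (\<Sum>n. ennreal (Q n \<omega>)) \<noteq> \<infinity>"
    by (intro nn_integral_PInf_AE) auto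
  then show ?thesis
  proof (rule AE_mp, intro AE_I2 impI)
    fix \<omega> assume "(\<Sum>n. ennreal (Q n \<omega>)) \<noteq> \<infinity>"
    then have "summable (\<lambda>n. Q n \<omega>)"
      using nonneg by (intro summable_suminf_not_top) auto
    then show "(\<lambda>n. Q n \<omega>) \<longlonglongrightarrow> 0" by (rule summable_LIMSEQ_zero)
  qed
qed

lemma (in prob_space) indep_vars_pair:
  assumes "indep_vars (\<lambda>_. N) Y I" "i \<in> I" "j \<in> I" "i \<noteq> j"
  shows "indep_var N (Y i) N (Y j)"
proof -
  have "indep_var (Pi\<^sub>M {i} (\<lambda>_. N)) (\<lambda>\<omega>. restrict (\<lambda>i. Y i \<omega>) {i})
      (Pi\<^sub>M {j} (\<lambda>_. N)) (\<lambda>\<omega>. restrict (\<lambda>i. Y i \<omega>) {j})"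
    using assms by (intro indep_var_restrict[where I=I]) auto
  then have "indep_var N ((\<lambda>x. x i) \<circ> (\<lambda>\<omega>. restrict (\<lambda>i. Y i \<omega>) {i}))
      N ((\<lambda>x. x j) \<circ> (\<lambda>\<omega>. restrict (\<lambda>i. Y i \<omega>) {j}))"
    by (rule indep_var_compose) (auto intro: measurable_component_singleton)
  then show ?thesis by (simp add: comp_def)
qed

text \<open>Only the diagonal survives when the square is expanded. Pairwise independence enters the
  variance estimate through this identity.\<close>

lemma (in prob_space) expectation_square_sum_orthogonal:
  fixes W :: "'i \<Rightarrow> 'a \<Rightarrow> real"
  assumes int: "\<And>i j. i \<in> I \<Longrightarrow> j \<in> I \<Longrightarrow> integrable M (\<lambda>\<omega>. W i \<omega> * W j \<omega>)"
    and orth: "\<And>i j. i \<in> I \<Longrightarrow> j \<in> I \<Longrightarrow> i \<noteq> j \<Longrightarrow> expectation (\<lambda>\<omega>. W i \<omega> * W j \<omega>) = 0"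
    and "finite I"
  shows "expectation (\<lambda>\<omega>. (\<Sum>i\<in>I. W i \<omega>)\<^sup>2) = (\<Sum>i\<in>I. expectation (\<lambda>\<omega>. (W i \<omega>)\<^sup>2))"
proof -
  have "expectation (\<lambda>\<omega>. (\<Sum>i\<in>I. W i \<omega>)\<^sup>2) = (\<Sum>i\<in>I. \<Sum>j\<in>I. expectation (\<lambda>\<omega>. W i \<omega> * W j \<omega>))"
    using int by (simp add: power2_eq_square sum_product)
  also have "\<dots> = (\<Sum>i\<in>I. \<Sum>j\<in>I. if j = i then expectation (\<lambda>\<omega>. W i \<omega> * W i \<omega>) else 0)"
    using orth by (intro sum.cong) auto
  finally show ?thesis
    using \<open>finite I\<close> by (simp add: power2_eq_square)
qed

section \<open>The strong law along geometrically growing indices\<close>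

text \<open>Rounding down loses at most 1, which is negligible against \<open>a^n\<close>. Sums of
  \<open>nat \<lfloor>a^n\<rfloor>\<close> terms can therefore be normalised by \<open>a^n\<close>
  itself.\<close>

lemma LIMSEQ_floor_power_ratio:
  fixes a :: real
  assumes "a > 1"
  shows "(\<lambda>n. real (nat \<lfloor>a^n\<rfloor>) / a^n) \<longlonglongrightarrow> 1"
proof (rule tendsto_sandwich)
  have apos: "a^n > 0" for n using assms by simp
  have "(\<lambda>n. 1 - (1/a)^n) \<longlonglongrightarrow> 1 - 0"
    using assms by (intro tendsto_intros LIMSEQ_power_zero) auto
  then show "(\<lambda>n. 1 - (1/a)^n) \<longlonglongrightarrow> 1" by simp
  show "\<forall>\<^sub>F n in sequentially. 1 - (1/a)^n \<le> real (nat \<lfloor>a^n\<rfloor>) / a^n"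
  proof (intro always_eventually allI)
    fix n
    have "a^n - 1 \<le> real (nat \<lfloor>a^n\<rfloor>)" by linarith
    then have "(a^n - 1) / a^n \<le> real (nat \<lfloor>a^n\<rfloor>) / a^n"
      using apos[of n] by (intro divide_right_mono) auto
    then show "1 - (1/a)^n \<le> real (nat \<lfloor>a^n\<rfloor>) / a^n"
      using apos[of n] assms by (simp add: diff_divide_distrib power_one_over)
  qed
  show "\<forall>\<^sub>F n in sequentially. real (nat \<lfloor>a^n\<rfloor>) / a^n \<le> 1"
  proof (intro always_eventually allI)
    fix n
    show "real (nat \<lfloor>a^n\<rfloor>) / a^n \<le> 1"
      using apos[of n] by (simp add: divide_le_eq)
  qed
  show "(\<lambda>n. 1::real) \<longlonglongrightarrow> 1" by simp
qed

text \<open>At stage \<open>n\<close> all summands are truncated at the same level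
  \<open>a^n\<close>, so they share the mean \<open>e n\<close>. The centred truncated sums vanish
  after normalisation because their variances are summable, and truncation is eventually without
  effect by Borel-Cantelli.\<close>

lemma (in prob_space) strong_law_along_powers:
  fixes Y :: "nat \<Rightarrow> 'a \<Rightarrow> real" and a :: real
  assumes a: "a > 1"
    and indep: "\<And>i j. i \<noteq> j \<Longrightarrow> indep_var borel (Y i) borel (Y j)"
    and ident: "\<And>i. distr M borel (Y i) = distr M borel (Y 0)"
    and int: "integrable M (Y 0)"
    and nonneg: "\<And>i \<omega>. 0 \<le> Y i \<omega>"
  shows "AE \<omega> in M. (\<lambda>n. (\<Sum>i<nat \<lfloor>a^n\<rfloor>. Y i \<omega>) / a^n) \<longlonglongrightarrow> expectation (Y 0)"
proof -
  define tr :: "nat \<Rightarrow> real \<Rightarrow> real" where "tr n y = (if y \<le> a^n then y else 0)" for n y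
  define k where "k n = nat \<lfloor>a^n\<rfloor>" for n
  define e where "e n = expectation (\<lambda>\<omega>. tr n (Y 0 \<omega>))" for n
  \<comment> \<open>Outside \<open>A n\<close> no summand is altered, so there the partial sum of
    the \<open>Y i\<close> equals \<open>D n \<omega> + real (k n) * e n\<close>.\<close>
  define D where "D n \<omega> = (\<Sum>i<k n. tr n (Y i \<omega>) - e n)" for n \<omega>
  define A where "A n = {\<omega> \<in> space M. \<exists>i<k n. a^n < Y i \<omega>}" for n
  define C where "C = a / (a - 1)"
  have apos: "a^n > 0" for n using a by simp
  have k_le: "real (k n) \<le> a^n" for n using apos[of n] by (simp add: k_def)
  have [measurable]: "Y i \<in> borel_measurable M" for i
    using indep[of i "Suc i"] by (auto dest: indep_var_rv1)
  have [measurable]: "tr n \<in> borel_measurable borel" for n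
    unfolding tr_def by measurable
  have [measurable]: "A n \<in> sets M" for n
    unfolding A_def by measurable
  have [measurable]: "D n \<in> borel_measurable M" for n
    unfolding D_def by measurable
  have E_ident: "expectation (\<lambda>\<omega>. g (Y i \<omega>)) = expectation (\<lambda>\<omega>. g (Y 0 \<omega>))"
    if [measurable]: "g \<in> borel_measurable borel" for g :: "real \<Rightarrow> real" and i
  proof -
    have "expectation (\<lambda>\<omega>. g (Y i \<omega>)) = integral\<^sup>L (distr M borel (Y i)) g"
      by (simp add: integral_distr)
    also have "\<dots> = expectation (\<lambda>\<omega>. g (Y 0 \<omega>))"
      unfolding ident[of i] by (simp add: integral_distr)
    finally show ?thesis .
  qed
  have tr_bound: "0 \<le> tr n (Y i \<omega>)" "tr n (Y i \<omega>) \<le> a^n" "tr n (Y i \<omega>) \<le> Y i \<omega>" for n i \<omega>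
    using nonneg[of i \<omega>] apos[of n] by (auto simp: tr_def)
  have int_tr: "integrable M (\<lambda>\<omega>. tr n (Y i \<omega>))" for n i
    by (rule integrable_const_bound[where B="a^n"]) (use tr_bound in auto)
  have e_bound: "0 \<le> e n" "e n \<le> a^n" for n
  proof -
    show "0 \<le> e n" unfolding e_def using tr_bound by (intro Bochner_Integration.integral_nonneg) auto
    have "e n \<le> expectation (\<lambda>_. a^n)"
      unfolding e_def using tr_bound int_tr by (intro integral_mono) auto
    then show "e n \<le> a^n" by (simp add: prob_space)
  qed
  have int_W: "integrable M (\<lambda>\<omega>. (tr n (Y i \<omega>) - e n) * (tr n (Y j \<omega>) - e n))" for n i j
  proof (rule integrable_const_bound[where B="a^n * a^n"])
    have "\<bar>tr n (Y i \<omega>) - e n\<bar> \<le> a^n" for i \<omega>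
      using tr_bound(1,2)[of n i \<omega>] e_bound[of n] by linarith
    then show "AE \<omega> in M. norm ((tr n (Y i \<omega>) - e n) * (tr n (Y j \<omega>) - e n)) \<le> a^n * a^n"
      using apos[of n] by (auto simp: abs_mult intro!: mult_mono)
  qed measurable
  have orth: "expectation (\<lambda>\<omega>. (tr n (Y i \<omega>) - e n) * (tr n (Y j \<omega>) - e n)) = 0"
    if "i \<noteq> j" for n i j
  proof -
    from indep[OF that] have ij: "indep_var borel ((\<lambda>y. tr n y - e n) \<circ> Y i) borel ((\<lambda>y. tr n y - e n) \<circ> Y j)"
      by (rule indep_var_compose) measurable
    have zero: "expectation (\<lambda>\<omega>. tr n (Y i \<omega>) - e n) = 0" for i
      using int_tr E_ident[of "tr n" i] by (simp add: e_def prob_space)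
    show ?thesis
      using indep_var_lebesgue_integral[OF ij] int_tr zero by (simp add: comp_def)
  qed
  have int_D: "integrable M (\<lambda>\<omega>. (D n \<omega>)\<^sup>2)" for n
    unfolding D_def power2_eq_square sum_product by (intro Bochner_Integration.integrable_sum int_W)
  have int_tr2: "integrable M (\<lambda>\<omega>. (tr n (Y 0 \<omega>))\<^sup>2)" for n
    by (rule integrable_const_bound[where B="(a^n)\<^sup>2"])
       (use tr_bound in \<open>auto intro!: power_mono\<close>)
  \<comment> \<open>Division by the square of \<open>a^n\<close> leaves the second moment over
    \<open>a^n\<close>, whose integrand is the summand of
    \<open>sum_inverse_powers_above_le\<close>.\<close>
  have E_D: "expectation (\<lambda>\<omega>. (D n \<omega>)\<^sup>2) \<le> a^n * expectation (\<lambda>\<omega>. (tr n (Y 0 \<omega>))\<^sup>2)" for n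
  proof -
    have "expectation (\<lambda>\<omega>. (D n \<omega>)\<^sup>2) = (\<Sum>i<k n. expectation (\<lambda>\<omega>. (tr n (Y i \<omega>) - e n)\<^sup>2))"
      unfolding D_def using int_W orth by (intro expectation_square_sum_orthogonal) auto
    also have "\<dots> = (\<Sum>i<k n. expectation (\<lambda>\<omega>. (tr n (Y 0 \<omega>) - e n)\<^sup>2))"
      by (intro sum.cong refl E_ident[of "\<lambda>y. (tr n y - e n)\<^sup>2"]) measurable
    also have "\<dots> = real (k n) * (expectation (\<lambda>\<omega>. (tr n (Y 0 \<omega>))\<^sup>2) - (e n)\<^sup>2)"
      using variance_eq[OF int_tr int_tr2, of n] by (simp add: e_def)
    also have "\<dots> \<le> real (k n) * expectation (\<lambda>\<omega>. (tr n (Y 0 \<omega>))\<^sup>2)"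
      by (intro mult_left_mono) auto
    also have "\<dots> \<le> a^n * expectation (\<lambda>\<omega>. (tr n (Y 0 \<omega>))\<^sup>2)"
      using k_le[of n] by (intro mult_right_mono Bochner_Integration.integral_nonneg) auto
    finally show ?thesis .
  qed
  \<comment> \<open>The union bound costs a factor \<open>k n \<le> a^n\<close>; moved inside the
    expectation, it gives the summand of \<open>sum_powers_below_le\<close>.\<close>
  have prob_A: "prob (A n) \<le> expectation (\<lambda>\<omega>. if a^n < Y 0 \<omega> then a^n else 0)" for n
  proof -
    define L where "L i = {\<omega> \<in> space M. a^n < Y i \<omega>}" for i
    have [measurable]: "L i \<in> sets M" for i unfolding L_def by measurable
    have ind: "expectation (\<lambda>\<omega>. if a^n < Y i \<omega> then 1 else 0 :: real) = prob (L i)" for i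
    proof -
      have "expectation (\<lambda>\<omega>. if a^n < Y i \<omega> then 1 else 0 :: real) = expectation (indicator (L i))"
        by (intro Bochner_Integration.integral_cong) (auto simp: L_def indicator_def)
      then show ?thesis by simp
    qed
    have "A n = (\<Union>i\<in>{..<k n}. L i)" by (auto simp: A_def L_def)
    then have "prob (A n) \<le> (\<Sum>i<k n. prob (L i))"
      by (simp add: finite_measure_subadditive_finite image_subset_iff)
    also have "\<dots> = (\<Sum>i<k n. prob (L 0))"
      unfolding ind[symmetric]
      by (intro sum.cong refl E_ident[of "\<lambda>y. if a^n < y then 1 else 0"]) measurable
    also have "\<dots> = real (k n) * prob (L 0)" by simp
    also have "\<dots> \<le> a^n * prob (L 0)"
      using k_le[of n] by (intro mult_right_mono) auto
    also have "\<dots> = expectation (\<lambda>\<omega>. a^n * (if a^n < Y 0 \<omega> then 1 else 0))"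
      by (simp only: integral_mult_right_zero ind)
    also have "\<dots> = expectation (\<lambda>\<omega>. if a^n < Y 0 \<omega> then a^n else 0)"
      by (intro Bochner_Integration.integral_cong) auto
    finally show ?thesis .
  qed
  have summable_A: "summable (\<lambda>n. prob (A n))"
  proof (rule summableI_nonneg_bounded)
    fix N
    have int_p: "integrable M (\<lambda>\<omega>. if a^n < Y 0 \<omega> then a^n else 0)" for n
      by (rule integrable_const_bound[where B="a^n"]) (use apos[of n] in auto)
    have "(\<Sum>n<N. prob (A n)) \<le> (\<Sum>n<N. expectation (\<lambda>\<omega>. if a^n < Y 0 \<omega> then a^n else 0))"
      by (intro sum_mono prob_A)
    also have "\<dots> = expectation (\<lambda>\<omega>. \<Sum>n<N. if a^n < Y 0 \<omega> then a^n else 0)"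
      using int_p by (simp add: Bochner_Integration.integral_sum)
    also have "\<dots> \<le> expectation (\<lambda>\<omega>. Y 0 \<omega> * C)"
      unfolding C_def using int int_p sum_powers_below_le[OF a nonneg]
      by (intro integral_mono) auto
    finally show "(\<Sum>n<N. prob (A n)) \<le> expectation (\<lambda>\<omega>. Y 0 \<omega> * C)" .
  qed simp
  have summable_D: "summable (\<lambda>n. expectation (\<lambda>\<omega>. (D n \<omega> / a^n)\<^sup>2))"
  proof (rule summableI_nonneg_bounded)
    fix N
    have "(\<Sum>n<N. expectation (\<lambda>\<omega>. (D n \<omega> / a^n)\<^sup>2))
        \<le> (\<Sum>n<N. expectation (\<lambda>\<omega>. (tr n (Y 0 \<omega>))\<^sup>2 / a^n))"
    proof (rule sum_mono)
      fix n
      have "expectation (\<lambda>\<omega>. (D n \<omega> / a^n)\<^sup>2) = expectation (\<lambda>\<omega>. (D n \<omega>)\<^sup>2) / (a^n)\<^sup>2"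
        by (simp add: power_divide)
      also have "\<dots> \<le> a^n * expectation (\<lambda>\<omega>. (tr n (Y 0 \<omega>))\<^sup>2) / (a^n)\<^sup>2"
        by (intro divide_right_mono E_D) auto
      also have "\<dots> = expectation (\<lambda>\<omega>. (tr n (Y 0 \<omega>))\<^sup>2 / a^n)"
        using apos[of n] by (simp add: power2_eq_square)
      finally show "expectation (\<lambda>\<omega>. (D n \<omega> / a^n)\<^sup>2)
          \<le> expectation (\<lambda>\<omega>. (tr n (Y 0 \<omega>))\<^sup>2 / a^n)" .
    qed
    also have "\<dots> = expectation (\<lambda>\<omega>. \<Sum>n<N. (tr n (Y 0 \<omega>))\<^sup>2 / a^n)"
      using int_tr2 by (simp add: Bochner_Integration.integral_sum)
    also have "\<dots> \<le> expectation (\<lambda>\<omega>. Y 0 \<omega> * C)"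
    proof (intro integral_mono)
      show "(\<Sum>n<N. (tr n (Y 0 \<omega>))\<^sup>2 / a^n) \<le> Y 0 \<omega> * C" for \<omega>
        unfolding C_def tr_def by (rule sum_inverse_powers_above_le[OF a nonneg])
    qed (use int int_tr2 in auto)
    finally show "(\<Sum>n<N. expectation (\<lambda>\<omega>. (D n \<omega> / a^n)\<^sup>2)) \<le> expectation (\<lambda>\<omega>. Y 0 \<omega> * C)" .
  qed simp
  have AE_D: "AE \<omega> in M. (\<lambda>n. (D n \<omega> / a^n)\<^sup>2) \<longlonglongrightarrow> 0"
    using int_D summable_D by (intro AE_tendsto_0_of_summable_integral) (auto simp: power_divide)
  \<comment> \<open>Borel-Cantelli: almost every point lies in only finitely many
    \<open>A n\<close>.\<close>
  have AE_A: "AE \<omega> in M. eventually (\<lambda>n. \<omega> \<in> space M - A n) sequentially"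
    using summable_A by (intro borel_cantelli_AE1) (auto simp: emeasure_eq_measure)
  have e_lim: "e \<longlonglongrightarrow> expectation (Y 0)"
    unfolding e_def
  proof (rule integral_dominated_convergence[where w="Y 0"])
    \<comment> \<open>For fixed \<open>\<omega>\<close> the level \<open>a^n\<close> eventually
      exceeds \<open>Y 0 \<omega>\<close>, and from then on truncation does nothing.\<close>
    show "AE \<omega> in M. (\<lambda>n. tr n (Y 0 \<omega>)) \<longlonglongrightarrow> Y 0 \<omega>"
    proof (intro AE_I2 tendsto_eventually)
      fix \<omega>
      obtain l where "Y 0 \<omega> < a^l" using real_arch_pow[OF a] by blast
      moreover have "a^l \<le> a^n" if "l \<le> n" for n
        using a that by (intro power_increasing) auto
      ultimately have "\<forall>\<^sub>F n in sequentially. Y 0 \<omega> \<le> a^n"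
        unfolding eventually_sequentially by (meson less_imp_le order_less_le_trans)
      then show "\<forall>\<^sub>F n in sequentially. tr n (Y 0 \<omega>) = Y 0 \<omega>"
        by eventually_elim (simp add: tr_def)
    qed
  qed (use int tr_bound in auto)
  have ke_lim: "(\<lambda>n. real (k n) / a^n * e n) \<longlonglongrightarrow> expectation (Y 0)"
    using tendsto_mult[OF LIMSEQ_floor_power_ratio[OF a] e_lim] by (simp add: k_def)
  show ?thesis
    using AE_D AE_A
  proof eventually_elim
    case (elim \<omega>)
    have "(\<lambda>n. sqrt ((D n \<omega> / a^n)\<^sup>2)) \<longlonglongrightarrow> sqrt 0"
      using elim(1) by (rule tendsto_real_sqrt)
    then have "(\<lambda>n. D n \<omega> / a^n) \<longlonglongrightarrow> 0"
      by (simp only: real_sqrt_abs real_sqrt_zero tendsto_rabs_zero_iff)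
    then have lim: "(\<lambda>n. D n \<omega> / a^n + real (k n) / a^n * e n) \<longlonglongrightarrow> expectation (Y 0)"
      using tendsto_add[OF _ ke_lim] by fastforce
    have "\<forall>\<^sub>F n in sequentially.
        D n \<omega> / a^n + real (k n) / a^n * e n = (\<Sum>i<nat \<lfloor>a^n\<rfloor>. Y i \<omega>) / a^n"
      using elim(2)
    proof eventually_elim
      case (elim n)
      then have "tr n (Y i \<omega>) = Y i \<omega>" if "i < k n" for i
        using that unfolding A_def tr_def by (metis (mono_tags, lifting) DiffE mem_Collect_eq not_le)
      then have "D n \<omega> = (\<Sum>i<k n. Y i \<omega>) - real (k n) * e n"
        by (simp add: D_def sum_subtractf)
      then show ?case by (simp add: k_def diff_divide_distrib)
    qed
    then show ?case by (rule Lim_transform_eventually[OF lim])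
  qed
qed

section \<open>Interpolation between consecutive powers\<close>

text \<open>If \<open>a^n \<le> m < a^Suc n\<close>, monotonicity traps \<open>S m / real m\<close>
  between the averages at the two powers, each off by a factor \<open>a\<close>. The ratios
  \<open>1 + 1 / real (Suc p)\<close> tend to 1 and are countable in number, which allows a common
  null set later.\<close>

lemma LIMSEQ_average_of_power_subsequences:
  fixes S :: "nat \<Rightarrow> real"
  assumes mono: "mono S" and "S 0 = 0"
    and lim: "\<And>p. (\<lambda>n. S (nat \<lfloor>(1 + 1 / real (Suc p))^n\<rfloor>) / (1 + 1 / real (Suc p))^n) \<longlonglongrightarrow> \<mu>"
  shows "(\<lambda>m. S m / real m) \<longlonglongrightarrow> \<mu>"
proof -
  have S_nonneg: "0 \<le> S m" for m using monoD[OF mono, of 0 m] assms(2) by simp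
  have \<mu>_nonneg: "0 \<le> \<mu>"
    by (rule LIMSEQ_le_const[OF lim[of 0]]) (auto intro!: divide_nonneg_nonneg S_nonneg)
  have sandwich: "\<forall>\<^sub>F m in sequentially. \<mu> / a - \<epsilon> \<le> S m / real m \<and> S m / real m \<le> a * \<mu> + \<epsilon>"
    if a: "a > 1" and V: "(\<lambda>n. S (nat \<lfloor>a^n\<rfloor>) / a^n) \<longlonglongrightarrow> \<mu>" and "\<epsilon> > 0" for a \<epsilon>
  proof -
    define V where "V n = S (nat \<lfloor>a^n\<rfloor>) / a^n" for n
    have V_lim: "V \<longlonglongrightarrow> \<mu>" using V unfolding V_def .
    have "(\<lambda>n. V n / a) \<longlonglongrightarrow> \<mu> / a" "(\<lambda>n. a * V (Suc n)) \<longlonglongrightarrow> a * \<mu>"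
      using a by (auto intro!: tendsto_intros V_lim filterlim_compose[OF V_lim filterlim_Suc])
    then have "\<forall>\<^sub>F n in sequentially. \<mu> / a - \<epsilon> < V n / a"
        "\<forall>\<^sub>F n in sequentially. a * V (Suc n) < a * \<mu> + \<epsilon>"
      using \<open>\<epsilon> > 0\<close> by (auto intro: order_tendstoD)
    then have "\<forall>\<^sub>F n in sequentially. \<mu> / a - \<epsilon> < V n / a \<and> a * V (Suc n) < a * \<mu> + \<epsilon>"
      by eventually_elim auto
    then obtain N where N: "\<And>n. n \<ge> N \<Longrightarrow> \<mu> / a - \<epsilon> < V n / a \<and> a * V (Suc n) < a * \<mu> + \<epsilon>"
      unfolding eventually_sequentially by blast
    show ?thesis
      unfolding eventually_sequentially
    proof (intro exI allI impI)
      fix m assume m: "m \<ge> Suc (nat \<lceil>a^N\<rceil>)"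
      then have mN: "a^N \<le> real m" by linarith
      have mpos: "real m > 0" using m by simp
      obtain l where l: "real m < a^l" using real_arch_pow[OF a] by blast
      \<comment> \<open>The first power above \<open>m\<close>; its predecessor \<open>n\<close>
        gives the bracket around \<open>m\<close>. Since \<open>m\<close> is at least
        \<open>a^N\<close>, \<open>q > N\<close>, so that \<open>n\<close> exists and is at least
        \<open>N\<close>.\<close>
      define q where "q = (LEAST l. real m < a^l)"
      have q: "real m < a^q" unfolding q_def by (rule LeastI[of _ l]) (rule l)
      have "q > N"
      proof (rule ccontr)
        assume "\<not> q > N"
        then have "a^q \<le> a^N" using a by (intro power_increasing) auto
        then show False using q mN by linarith
      qed
      then obtain n where n: "q = Suc n" "n \<ge> N" by (cases q) auto
      have lo: "a^n \<le> real m"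
        using not_less_Least[of n "\<lambda>l. real m < a^l"] n by (simp add: q_def[symmetric] not_less)
      have hi: "real m < a^Suc n" using q n by simp
      have apos: "a^n > 0" using a by simp
      have "nat \<lfloor>a^n\<rfloor> \<le> m" "m \<le> nat \<lfloor>a^Suc n\<rfloor>" using lo hi by linarith+
      then have S: "S (nat \<lfloor>a^n\<rfloor>) \<le> S m" "S m \<le> S (nat \<lfloor>a^Suc n\<rfloor>)"
        using mono by (auto dest: monoD)
      have "V n / a = S (nat \<lfloor>a^n\<rfloor>) / a^Suc n" by (simp add: V_def mult.commute)
      also have "\<dots> \<le> S m / real m"
        using S hi mpos S_nonneg by (intro frac_le) auto
      finally have 1: "V n / a \<le> S m / real m" .
      have "S m / real m \<le> S (nat \<lfloor>a^Suc n\<rfloor>) / a^n"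
        using S lo apos S_nonneg by (intro frac_le) auto
      also have "\<dots> = a * V (Suc n)" using a by (simp add: V_def)
      finally have 2: "S m / real m \<le> a * V (Suc n)" .
      show "\<mu> / a - \<epsilon> \<le> S m / real m \<and> S m / real m \<le> a * \<mu> + \<epsilon>"
        using 1 2 N[OF n(2)] by linarith
    qed
  qed
  show ?thesis
  proof (rule LIMSEQ_I)
    fix r :: real assume r: "r > 0"
    have l0: "(\<lambda>p. 1 + 1 / real (Suc p)) \<longlonglongrightarrow> 1 + 0"
      using LIMSEQ_inverse_real_of_nat by (intro tendsto_intros) (simp add: inverse_eq_divide)
    have "(\<lambda>p. (1 + 1 / real (Suc p)) * \<mu>) \<longlonglongrightarrow> (1 + 0) * \<mu>"
        "(\<lambda>p. \<mu> / (1 + 1 / real (Suc p))) \<longlonglongrightarrow> \<mu> / (1 + 0)"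
      by (rule tendsto_mult[OF l0 tendsto_const], rule tendsto_divide[OF tendsto_const l0]) simp
    then have "\<forall>\<^sub>F p in sequentially. (1 + 1 / real (Suc p)) * \<mu> < \<mu> + r / 2"
        "\<forall>\<^sub>F p in sequentially. \<mu> - r / 2 < \<mu> / (1 + 1 / real (Suc p))"
      using r by (auto intro: order_tendstoD)
    then have "\<forall>\<^sub>F p in sequentially. (1 + 1 / real (Suc p)) * \<mu> < \<mu> + r / 2 \<and>
        \<mu> - r / 2 < \<mu> / (1 + 1 / real (Suc p))"
      by eventually_elim auto
    \<comment> \<open>Half of \<open>r\<close> absorbs the error from the factor \<open>a\<close>;
      the other half serves as \<open>\<epsilon>\<close> in \<open>sandwich\<close>.\<close>
    then obtain p where p: "(1 + 1 / real (Suc p)) * \<mu> < \<mu> + r / 2"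
        "\<mu> - r / 2 < \<mu> / (1 + 1 / real (Suc p))"
      unfolding eventually_sequentially by blast
    have "\<forall>\<^sub>F m in sequentially. \<mu> / (1 + 1 / real (Suc p)) - r / 2 \<le> S m / real m \<and>
        S m / real m \<le> (1 + 1 / real (Suc p)) * \<mu> + r / 2"
      using r by (intro sandwich lim) auto
    then have "\<forall>\<^sub>F m in sequentially. norm (S m / real m - \<mu>) < r"
    proof eventually_elim
      case (elim m)
      then show ?case using p unfolding real_norm_def by linarith
    qed
    then show "\<exists>no. \<forall>n\<ge>no. norm (S n / real n - \<mu>) < r"
      unfolding eventually_sequentially .
  qed
qed

section \<open>The strong law in Euclidean space\<close>

lemma (in prob_space) strong_law_nonneg:
  fixes Y :: "nat \<Rightarrow> 'a \<Rightarrow> real"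
  assumes "\<And>i j. i \<noteq> j \<Longrightarrow> indep_var borel (Y i) borel (Y j)"
    and "\<And>i. distr M borel (Y i) = distr M borel (Y 0)"
    and "integrable M (Y 0)"
    and "\<And>i \<omega>. 0 \<le> Y i \<omega>"
  shows "AE \<omega> in M. (\<lambda>n. (\<Sum>i<n. Y i \<omega>) / real n) \<longlonglongrightarrow> expectation (Y 0)"
proof -
  have "AE \<omega> in M. \<forall>p. (\<lambda>n. (\<Sum>i<nat \<lfloor>(1 + 1 / real (Suc p))^n\<rfloor>. Y i \<omega>) /
      (1 + 1 / real (Suc p))^n) \<longlonglongrightarrow> expectation (Y 0)"
    unfolding AE_all_countable by (intro allI strong_law_along_powers assms) simp
  then show ?thesis
  proof eventually_elim
    case (elim \<omega>)
    have "mono (\<lambda>n. \<Sum>i<n. Y i \<omega>)"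
      using assms(4) by (intro monoI sum_mono2) auto
    then show ?case
      using elim by (intro LIMSEQ_average_of_power_subsequences) auto
  qed
qed

lemma distr_compose_cong:
  assumes "distr M N X = distr M N Y"
    and "g \<in> measurable N K" "X \<in> measurable M N" "Y \<in> measurable M N"
  shows "distr M K (\<lambda>\<omega>. g (X \<omega>)) = distr M K (\<lambda>\<omega>. g (Y \<omega>))"
  using arg_cong[OF assms(1), of "\<lambda>D. distr D K g"] assms(2-4)
  by (simp add: distr_distr comp_def)

theorem (in prob_space) strong_law_of_large_numbers:
  fixes Y :: "nat \<Rightarrow> 'a \<Rightarrow> 'b::euclidean_space"
  assumes indep: "\<And>i j. i \<noteq> j \<Longrightarrow> indep_var borel (Y i) borel (Y j)"
    and ident: "\<And>i. distr M borel (Y i) = distr M borel (Y 0)"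
    and int: "integrable M (Y 0)"
  shows "AE \<omega> in M. (\<lambda>n. (\<Sum>i<n. Y i \<omega>) /\<^sub>R real n) \<longlonglongrightarrow> expectation (Y 0)"
proof -
  have Y[measurable]: "Y i \<in> borel_measurable M" for i
    using indep[of i "Suc i"] by (auto dest: indep_var_rv1)
  \<comment> \<open>With \<open>c\<close> equal to a basis vector or to its negative, this yields
    the positive and the negative part of a coordinate, both nonnegative.\<close>
  have part: "AE \<omega> in M. (\<lambda>n. (\<Sum>i<n. max (Y i \<omega> \<bullet> c) 0) / real n)
      \<longlonglongrightarrow> expectation (\<lambda>\<omega>. max (Y 0 \<omega> \<bullet> c) 0)" for c
  proof (rule strong_law_nonneg)
    have [measurable]: "(\<lambda>y. max (y \<bullet> c) 0) \<in> borel_measurable borel" by measurable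
    show "indep_var borel (\<lambda>\<omega>. max (Y i \<omega> \<bullet> c) 0) borel (\<lambda>\<omega>. max (Y j \<omega> \<bullet> c) 0)"
      if "i \<noteq> j" for i j
      using indep_var_compose[OF indep[OF that], of "\<lambda>y. max (y \<bullet> c) 0" borel "\<lambda>y. max (y \<bullet> c) 0" borel]
      by (simp add: comp_def)
    show "distr M borel (\<lambda>\<omega>. max (Y i \<omega> \<bullet> c) 0) = distr M borel (\<lambda>\<omega>. max (Y 0 \<omega> \<bullet> c) 0)" for i
      by (rule distr_compose_cong[OF ident[of i]]) measurable
  qed (use int in auto)
  have "AE \<omega> in M. \<forall>b\<in>Basis.
      (\<lambda>n. (\<Sum>i<n. max (Y i \<omega> \<bullet> b) 0) / real n) \<longlonglongrightarrow> expectation (\<lambda>\<omega>. max (Y 0 \<omega> \<bullet> b) 0) \<and>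
      (\<lambda>n. (\<Sum>i<n. max (Y i \<omega> \<bullet> - b) 0) / real n) \<longlonglongrightarrow> expectation (\<lambda>\<omega>. max (Y 0 \<omega> \<bullet> - b) 0)"
    by (intro AE_finite_allI finite_Basis AE_conjI part)
  then show ?thesis
  proof eventually_elim
    case (elim \<omega>)
    have split: "max (y \<bullet> b) 0 - max (y \<bullet> - b) 0 = y \<bullet> b" for y b :: 'b
      by (simp add: max_def)
    show ?case
    proof (subst tendsto_componentwise_iff, intro ballI)
      fix b :: 'b assume b: "b \<in> Basis"
      have "(\<lambda>n. (\<Sum>i<n. max (Y i \<omega> \<bullet> b) 0) / real n - (\<Sum>i<n. max (Y i \<omega> \<bullet> - b) 0) / real n)
          \<longlonglongrightarrow> expectation (\<lambda>\<omega>. max (Y 0 \<omega> \<bullet> b) 0) - expectation (\<lambda>\<omega>. max (Y 0 \<omega> \<bullet> - b) 0)"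
        using elim b by (intro tendsto_diff) auto
      also have "expectation (\<lambda>\<omega>. max (Y 0 \<omega> \<bullet> b) 0) - expectation (\<lambda>\<omega>. max (Y 0 \<omega> \<bullet> - b) 0)
          = expectation (\<lambda>\<omega>. max (Y 0 \<omega> \<bullet> b) 0 - max (Y 0 \<omega> \<bullet> - b) 0)"
        using int by (intro Bochner_Integration.integral_diff[symmetric]) auto
      also have "\<dots> = expectation (Y 0) \<bullet> b"
        unfolding split using int by simp
      also have "(\<lambda>n. (\<Sum>i<n. max (Y i \<omega> \<bullet> b) 0) / real n - (\<Sum>i<n. max (Y i \<omega> \<bullet> - b) 0) / real n)
          = (\<lambda>n. ((\<Sum>i<n. Y i \<omega>) /\<^sub>R real n) \<bullet> b)"
        unfolding diff_divide_distrib[symmetric] sum_subtractf[symmetric] split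
        by (simp add: inner_sum_left divide_inverse mult.commute)
      finally show "(\<lambda>n. ((\<Sum>i<n. Y i \<omega>) /\<^sub>R real n) \<bullet> b) \<longlonglongrightarrow> expectation (Y 0) \<bullet> b" .
    qed
  qed
qed

section \<open>Expectations of random points of a convex set\<close>

text \<open>If the mean were outside \<open>S\<close>, a separating hyperplane through it would carry almost all of
  the mass, so that \<open>S\<close> could be replaced by a slice of smaller dimension.\<close>

lemma (in prob_space) expectation_in_convex:
  fixes Y :: "'a \<Rightarrow> 'b::euclidean_space"
  assumes int: "integrable M Y" and "convex S" and "AE \<omega> in M. Y \<omega> \<in> S"
  shows "expectation Y \<in> S"
  using assms(2,3)
\<comment> \<open>The shift by 1 accounts for \<open>aff_dim\<close> being -1 on the empty
  set.\<close>
proof (induction "nat (aff_dim S + 1)" arbitrary: S rule: less_induct)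
  case (less S)
  define m where "m = expectation Y"
  show ?case
  proof (rule ccontr)
    assume "expectation Y \<notin> S"
    then have mS: "m \<notin> S" by (simp add: m_def)
    have "S \<noteq> {}"
      using less.prems(2) AE_False by auto
    \<comment> \<open>The normal \<open>a\<close> is chosen along the affine hull of
      \<open>insert m S\<close>, so the hyperplane through \<open>m\<close> cannot contain all of
      \<open>S\<close>.\<close>
    then obtain a b where a: "m + a \<in> affine hull (insert m S)" "a \<noteq> 0" "a \<bullet> m \<le> b"
        "\<And>x. x \<in> S \<Longrightarrow> a \<bullet> x \<ge> b"
      using separating_hyperplane_set_point_inaff[OF less.prems(1) _ mS] by metis
    define S' where "S' = S \<inter> {x. a \<bullet> x = a \<bullet> m}"
    \<comment> \<open>This difference is almost surely nonnegative by separation and has mean 0,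
      hence vanishes almost surely.\<close>
    have "AE \<omega> in M. a \<bullet> Y \<omega> - a \<bullet> m = 0"
    proof (subst integral_nonneg_eq_0_iff_AE[symmetric])
      show "AE \<omega> in M. 0 \<le> a \<bullet> Y \<omega> - a \<bullet> m"
        using less.prems(2) by eventually_elim (use a in force)
      show "expectation (\<lambda>\<omega>. a \<bullet> Y \<omega> - a \<bullet> m) = 0"
        using int by (simp add: m_def prob_space)
    qed (use int in auto)
    then have AE': "AE \<omega> in M. Y \<omega> \<in> S'"
      using less.prems(2) by eventually_elim (auto simp: S'_def)
    have conv: "convex S'"
      unfolding S'_def by (intro convex_Int less.prems(1) convex_hyperplane)
    \<comment> \<open>Equal hulls would put \<open>m + a\<close> on the hyperplane through
      \<open>m\<close> with normal \<open>a\<close>, forcing \<open>a = 0\<close>.\<close>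
    have "affine hull S' \<noteq> affine hull S"
    proof
      assume eq: "affine hull S' = affine hull S"
      have "affine hull S' \<subseteq> {x. a \<bullet> x = a \<bullet> m}"
        by (rule hull_minimal) (auto simp: S'_def affine_hyperplane)
      then have "insert m S \<subseteq> {x. a \<bullet> x = a \<bullet> m}"
        using eq hull_subset[of S affine] by auto
      then have "affine hull (insert m S) \<subseteq> {x. a \<bullet> x = a \<bullet> m}"
        by (rule hull_minimal) (rule affine_hyperplane)
      then show False using a(1,2) by (auto simp: inner_add_right)
    qed
    then have "affine hull S' \<subset> affine hull S"
      using hull_mono[of S' S affine] by (auto simp: S'_def)
    then have "aff_dim S' < aff_dim S" by (rule aff_dim_psubset)
    moreover have "-1 \<le> aff_dim S'" by (rule aff_dim_geq)
    ultimately have "nat (aff_dim S' + 1) < nat (aff_dim S + 1)" by linarith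
    then have "expectation Y \<in> S'" using less.hyps conv AE' by blast
    then show False using mS by (simp add: S'_def m_def)
  qed
qed

section \<open>Continuity of the inverse and the limit of the means\<close>

text \<open>An injective holomorphic map has a holomorphic inverse on its image, and
  \<open>inv_into U f\<close> agrees with it there.\<close>

lemma continuous_inv_into_holomorphic:
  assumes "f holomorphic_on U" "open U" "inj_on f U"
  shows "continuous_on (f ` U) (inv_into U f)"
proof -
  obtain g where "g holomorphic_on f ` U" "\<And>z. z \<in> U \<Longrightarrow> g (f z) = z"
    using holomorphic_has_inverse[OF assms] by metis
  then show ?thesis
    using assms(3) by (subst continuous_on_cong[OF refl, where g=g])
      (auto simp: holomorphic_on_imp_continuous_on)
qed

theorem theorem1p4:
  fixes \<alpha> :: complex and U :: "complex set" and f :: "complex \<Rightarrow> complex"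
    and M :: "'a measure" and X :: "nat \<Rightarrow> 'a \<Rightarrow> real"
  assumes "\<alpha> \<in> closed_lower_half_plane"
    and "simply_connected_domain U"
    and "closed_upper_half_plane - {\<alpha>} \<subseteq> U"
    and "f holomorphic_on U"
    and "inj_on f U"
    and "convex (f ` (closed_upper_half_plane - {\<alpha>}))"
    and "prob_space M"
    and "iid_from_1 M X"
    and "\<forall>i\<ge>1. continuous_random_variable M (X i)"
    and "integrable M (\<lambda>\<omega>. cmod (f (complex_of_real (X 1 \<omega>))))"
  shows "AE \<omega> in M.
    (\<lambda>n. inv_into U f ((1 / of_nat n) * (\<Sum>j=1..n. f (complex_of_real (X j \<omega>)))))
      \<longlonglongrightarrow> inv_into U f (prob_space.expectation M (\<lambda>\<omega>. f (complex_of_real (X 1 \<omega>))))"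
proof -
  interpret prob_space M by fact
  define g where "g x = f (complex_of_real x)" for x
  define m where "m = expectation (\<lambda>\<omega>. g (X 1 \<omega>))"
  have openU: "open U" using assms(2) by (simp add: simply_connected_domain_def)
  \<comment> \<open>A real number can equal \<open>\<alpha>\<close> only at
    \<open>Re \<alpha>\<close>. Excluding that one point covers real and nonreal
    \<open>\<alpha>\<close> alike, and it has probability 0 for \<open>X 1\<close>.\<close>
  have real_in: "complex_of_real x \<in> closed_upper_half_plane - {\<alpha>}" if "x \<noteq> Re \<alpha>" for x
    using that by (auto simp: closed_upper_half_plane_def)
  have g_meas[measurable]: "g \<in> borel_measurable borel"
  \<comment> \<open>If \<open>\<alpha>\<close> is real it may lie outside \<open>U\<close>, where
    \<open>f\<close> is arbitrary; a single exceptional point does not affect Borel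
    measurability.\<close>
  proof (rule borel_measurable_continuous_countable_exceptions[of "{Re \<alpha>}"])
    have "complex_of_real ` (- {Re \<alpha>}) \<subseteq> U"
      using real_in assms(3) by blast
    then show "continuous_on (- {Re \<alpha>}) g"
      unfolding g_def
      by (rule continuous_on_compose2[OF holomorphic_on_imp_continuous_on[OF assms(4)]
            continuous_on_of_real[OF continuous_on_id]])
  qed simp
  have X_meas[measurable]: "X i \<in> borel_measurable M" if "i \<ge> 1" for i
    using assms(9) that by (simp add: continuous_random_variable_def)
  have [measurable]: "X 1 \<in> borel_measurable M" by (rule X_meas) simp
  have int: "integrable M (\<lambda>\<omega>. g (X 1 \<omega>))"
    unfolding g_def
    by (rule integrable_norm_cancel[OF assms(10)]) (simp add: g_def[symmetric])
  \<comment> \<open>The family \<open>X\<close> starts at index 1, the strong law at 0; hence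
    \<open>Suc i\<close>.\<close>
  have "AE \<omega> in M. (\<lambda>n. (\<Sum>i<n. g (X (Suc i) \<omega>)) /\<^sub>R real n) \<longlonglongrightarrow> expectation (\<lambda>\<omega>. g (X (Suc 0) \<omega>))"
  proof (rule strong_law_of_large_numbers)
    have indep: "indep_vars (\<lambda>_. borel) X {1..}" using assms(8) by (simp add: iid_from_1_def)
    show "indep_var borel (\<lambda>\<omega>. g (X (Suc i) \<omega>)) borel (\<lambda>\<omega>. g (X (Suc j) \<omega>))"
      if "i \<noteq> j" for i j
    proof -
      have "indep_var borel (X (Suc i)) borel (X (Suc j))"
        by (rule indep_vars_pair[OF indep]) (use that in auto)
      then have "indep_var borel (g \<circ> X (Suc i)) borel (g \<circ> X (Suc j))"
        by (rule indep_var_compose) measurable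
      then show ?thesis by (simp add: comp_def)
    qed
    show "distr M borel (\<lambda>\<omega>. g (X (Suc i) \<omega>)) = distr M borel (\<lambda>\<omega>. g (X (Suc 0) \<omega>))" for i
    proof (rule distr_compose_cong[OF _ g_meas])
      have "distr M borel (X (Suc i)) = distr M borel (X 1)"
        by (rule assms(8)[unfolded iid_from_1_def, THEN conjunct2, rule_format]) simp
      then show "distr M borel (X (Suc i)) = distr M borel (X (Suc 0))" by simp
    qed (auto intro: X_meas)
  qed (use int in simp)
  then have lln: "AE \<omega> in M. (\<lambda>n. (\<Sum>i<n. g (X (Suc i) \<omega>)) /\<^sub>R real n) \<longlonglongrightarrow> m"
    by (simp add: m_def)
  have "AE \<omega> in M. X 1 \<omega> \<noteq> Re \<alpha>"
  proof (rule AE_I')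
    have "measure M {\<omega> \<in> space M. X 1 \<omega> = Re \<alpha>} = 0"
      using assms(9) by (simp add: continuous_random_variable_def)
    then show "{\<omega> \<in> space M. X 1 \<omega> = Re \<alpha>} \<in> null_sets M"
      by (intro null_setsI) (auto simp: emeasure_eq_measure)
  qed auto
  then have "AE \<omega> in M. g (X 1 \<omega>) \<in> f ` (closed_upper_half_plane - {\<alpha>})"
    by eventually_elim (use real_in in \<open>auto simp: g_def\<close>)
  then have "m \<in> f ` (closed_upper_half_plane - {\<alpha>})"
    unfolding m_def by (intro expectation_in_convex int assms(6))
  then have mU: "m \<in> f ` U" using assms(3) by auto
  \<comment> \<open>Openness of the image turns continuity on it into continuity at \<open>m\<close>
    in the whole plane, so any sequence tending to \<open>m\<close> can be composed with
    \<open>inv_into U f\<close>.\<close>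
  have "open (f ` U)" by (rule open_mapping_thm3[OF assms(4) openU assms(5)])
  then have "isCont (inv_into U f) m"
    using mU continuous_inv_into_holomorphic[OF assms(4) openU assms(5)]
    by (metis continuous_on_eq_continuous_at)
  then have cont: "((\<lambda>n. inv_into U f (s n)) \<longlonglongrightarrow> inv_into U f m)" if "s \<longlonglongrightarrow> m" for s :: "nat \<Rightarrow> complex"
    using that by (rule isCont_tendsto_compose)
  show ?thesis
    using lln
  proof eventually_elim
    case (elim \<omega>)
    \<comment> \<open>This holds for \<open>n = 0\<close> as well: both sums are empty, so both
      sides are 0.\<close>
    have "(1 / of_nat n) * (\<Sum>j=1..n. f (complex_of_real (X j \<omega>)))
        = (\<Sum>i<n. g (X (Suc i) \<omega>)) /\<^sub>R real n" for n
      by (simp add: g_def sum.atLeast1_atMost_eq scaleR_conv_of_real divide_inverse)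
    then show ?case
      using cont[OF elim] by (simp add: m_def g_def)
  qed
qed

end
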